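(* Suppose $k\ge2$. Then $$\tilde R_k(\epsilon,n)=\Omega\Big(\frac{1}{n^2\epsilon^2}\Big).$$
   Context: Here $k,n\in\mathbb N$ with $k\le n$, and $\epsilon>0$ is the privacy parameter. **Graphons and random graphs.** A graphon is a bounded measurable function $W:[0,1]^2\to[0,\infty)$ with $W(x,y)=W(y,x)$. For $\|W\|_\infty\le1$, a $W$-random graph $G\sim G_n(W)$ on $[n]$ is obtained by drawing i.i.d. uniform labels $x_1,\dots,x_n\in[0,1]$ and then, conditionally on the labels, joining each pair $i<j$ independently with probability $W(x_i,x_j)$. **The class $\tilde{\mathcal W}[k]$.** It is the set of all graphons $W$ (not required to satisfy $\int W=1$) with $\|W\|_\infty\le1$ such that for some $A\in\mathbb R_{\ge0}^{k\times k}$ and some partition $(I_1,\dots,I_k)$ of $[0,1]$ into adjacent intervals of (potentially different) lengths in $[\frac1{4k},\frac4k]$, $W$ is the step function which equals $A_{ij}$ on $I_i\times I_j$ for all $i,j\in[k]$. **Distance.** $\delta_2(U,U')=\inf_\phi\|U^\phi-U'\|_2$, where $\phi$ ranges over measure-preserving bijections of $[0,1]$, $U^\phi(x,y)=U(\phi(x),\phi(y))$, and $\|\cdot\|_2$ is the $L^2([0,1]^2)$ norm. For a matrix $B\in\mathbb R^{k\times k}$, $\delta_2(B,W)=\delta_2(W[B],W)$, where $W[B]$ is the step function equal to $B_{ij}$ on $J_i\times J_j$, with $J_1,\dots,J_k$ the partition of $[0,1]$ into adjacent intervals of length $1/k$. **Node differential privacy.** $\mathcal G_n$ is the set of undirected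 graphs on $[n]$ without self-loops. Rewiring a vertex means inserting or removing an arbitrary set of edges adjacent to it; $d_v(G_1,G_2)$ is the minimum number of vertices of $G_1$ that need to be rewired to obtain $G_2$. A randomized algorithm $\mathcal A$ on $\mathcal G_n$ is $\epsilon$-node-DP if $\mathbb P(\mathcal A(G_1)\in S)\le e^{\epsilon d_v(G_1,G_2)}\,\mathbb P(\mathcal A(G_2)\in S)$ for all $G_1,G_2\in\mathcal G_n$ and all measurable $S$. **Rate.** $$\tilde R_k(\epsilon,n)=\min_{\mathcal A\ \epsilon\text{-node-DP}}\ \max_{W\in\tilde{\mathcal W}[k]}\ \mathbb E_{G\sim G_n(W),\,\hat B\sim\mathcal A_G}\big[\delta_2(\hat B,W)^2\big],$$ where $\mathcal A$ ranges over $\epsilon$-node-DP algorithms which on input $G\in\mathcal G_n$ output a matrix $\hat B\in\mathbb R^{k\times k}$, and $\mathcal A_G$ is the distribution of the output on input $G$.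
   Formalization: The bound is proved as Ω(min(1, 1/(n²ε²))) with one universal constant for all k ≥ 2, n ≥ k, ε > 0; without the cap it fails as nε → 0, since always outputting the zero matrix is private with risk at most 1. *)

theory Defs
  imports "HOL-Probability.Probability"
begin

section \<open>Graphons\<close>

text \<open>Graphons are functions on the unit square. They are represented by functions on the whole
  plane whose values outside the unit square never matter: every measure and every condition below
  is relative to the unit interval.\<close>

abbreviation unit_interval :: "real measure" where
  "unit_interval \<equiv> restrict_space lborel {0..1}"

definition graphon :: "(real \<Rightarrow> real \<Rightarrow> real) \<Rightarrow> bool" where
  "graphon W \<longleftrightarrow>
     (\<lambda>(x, y). W x y) \<in> borel_measurable (unit_interval \<Otimes>\<^sub>M unit_interval) \<and>
     (\<exists>C. \<forall>x\<in>{0..1}. \<forall>y\<in>{0..1}. W x y \<le> C) \<and>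
     (\<forall>x\<in>{0..1}. \<forall>y\<in>{0..1}. 0 \<le> W x y) \<and>
     (\<forall>x\<in>{0..1}. \<forall>y\<in>{0..1}. W x y = W y x)"

text \<open>Ordered partitions of the unit interval into \<open>k\<close> adjacent intervals, numbered from left to
  right; it is left open which of two neighbouring intervals contains the common endpoint.\<close>

definition interval_partition :: "nat \<Rightarrow> (nat \<Rightarrow> real set) \<Rightarrow> bool" where
  "interval_partition k I \<longleftrightarrow>
     (\<forall>i\<in>{1..k}. is_interval (I i)) \<and>
     (\<Union>i\<in>{1..k}. I i) = {0..1} \<and>
     (\<forall>i\<in>{1..k}. \<forall>j\<in>{1..k}. i < j \<longrightarrow> (\<forall>x\<in>I i. \<forall>y\<in>I j. x < y))"

text \<open>The class of step graphons bounded by 1 with \<open>k\<close> steps of lengths between \<open>1/(4k)\<close> and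
  \<open>4/k\<close>. The supremum norm is taken pointwise; as all steps have positive length, this agrees with
  the essential supremum.\<close>

definition step_graphons :: "nat \<Rightarrow> (real \<Rightarrow> real \<Rightarrow> real) set" where
  "step_graphons k = {W. graphon W \<and> (\<forall>x\<in>{0..1}. \<forall>y\<in>{0..1}. W x y \<le> 1) \<and>
     (\<exists>A I. (\<forall>i\<in>{1..k}. \<forall>j\<in>{1..k}. (0::real) \<le> A i j) \<and>
        interval_partition k I \<and>
        (\<forall>i\<in>{1..k}. measure lborel (I i) \<in> {1 / (4 * real k)..4 / real k}) \<and>
        (\<forall>i\<in>{1..k}. \<forall>j\<in>{1..k}. \<forall>x\<in>I i. \<forall>y\<in>I j. W x y = A i j))}"

definition L2_norm_graphon :: "(real \<Rightarrow> real \<Rightarrow> real) \<Rightarrow> real" where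
  "L2_norm_graphon U = sqrt (LINT (x, y)|(unit_interval \<Otimes>\<^sub>M unit_interval). (U x y)\<^sup>2)"

definition mp_bijections :: "(real \<Rightarrow> real) set" where
  "mp_bijections = {\<phi> \<in> unit_interval \<rightarrow>\<^sub>M unit_interval.
     bij_betw \<phi> {0..1} {0..1} \<and> distr unit_interval unit_interval \<phi> = unit_interval}"

definition delta2 :: "(real \<Rightarrow> real \<Rightarrow> real) \<Rightarrow> (real \<Rightarrow> real \<Rightarrow> real) \<Rightarrow> real" where
  "delta2 U U' = (INF \<phi>\<in>mp_bijections. L2_norm_graphon (\<lambda>x y. U (\<phi> x) (\<phi> y) - U' x y))"

text \<open>A \<open>k\<close> by \<open>k\<close> real matrix is an element of the product space over
  \<open>{1..k} \<times> {1..k}\<close>, whose sigma-algebra is the Borel sigma-algebra of matrices.\<close>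

abbreviation matrix_space :: "nat \<Rightarrow> (nat \<times> nat \<Rightarrow> real) measure" where
  "matrix_space k \<equiv> (\<Pi>\<^sub>M p\<in>{1..k} \<times> {1..k}. borel)"

definition equal_block :: "nat \<Rightarrow> nat \<Rightarrow> real set" where
  "equal_block k i = (if i = k then {(real i - 1) / real k..real i / real k}
                      else {(real i - 1) / real k..<real i / real k})"

definition graphon_of_matrix :: "nat \<Rightarrow> (nat \<times> nat \<Rightarrow> real) \<Rightarrow> real \<Rightarrow> real \<Rightarrow> real" where
  "graphon_of_matrix k B x y = (\<Sum>i\<in>{1..k}. \<Sum>j\<in>{1..k}.
     B (i, j) * indicator (equal_block k i) x * indicator (equal_block k j) y)"

definition delta2_matrix :: "nat \<Rightarrow> (nat \<times> nat \<Rightarrow> real) \<Rightarrow> (real \<Rightarrow> real \<Rightarrow> real) \<Rightarrow> real" where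
  "delta2_matrix k B W = delta2 (graphon_of_matrix k B) W"

section \<open>Graphs, random graphs and node differential privacy\<close>

text \<open>A graph on the vertices \<open>{1..n}\<close> is identified with its set of edges.\<close>

definition graphs :: "nat \<Rightarrow> nat set set set" where
  "graphs n = Pow {e. e \<subseteq> {1..n} \<and> card e = 2}"

definition vertex_pairs :: "nat \<Rightarrow> (nat \<times> nat) set" where
  "vertex_pairs n = {(i, j). i \<in> {1..n} \<and> j \<in> {1..n} \<and> i < j}"

definition random_graph_of_labels ::
    "nat \<Rightarrow> (real \<Rightarrow> real \<Rightarrow> real) \<Rightarrow> (nat \<Rightarrow> real) \<Rightarrow> nat set set pmf" where
  "random_graph_of_labels n W x =
     map_pmf (\<lambda>f. {{i, j} | i j. (i, j) \<in> vertex_pairs n \<and> f (i, j)})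
       (Pi_pmf (vertex_pairs n) False (\<lambda>(i, j). bernoulli_pmf (W (x i) (x j))))"

definition random_graph :: "nat \<Rightarrow> (real \<Rightarrow> real \<Rightarrow> real) \<Rightarrow> nat set set measure" where
  "random_graph n W =
     (\<Pi>\<^sub>M i\<in>{1..n}. unit_interval) \<bind> (\<lambda>x. measure_pmf (random_graph_of_labels n W x))"

text \<open>Rewiring the vertex \<open>v\<close> changes only edges at \<open>v\<close>.\<close>

definition rewiring :: "nat \<Rightarrow> nat \<Rightarrow> (nat set set \<times> nat set set) set" where
  "rewiring n v = {(G, H). G \<in> graphs n \<and> H \<in> graphs n \<and> (\<forall>e. v \<notin> e \<longrightarrow> (e \<in> G \<longleftrightarrow> e \<in> H))}"

definition node_distance :: "nat \<Rightarrow> nat set set \<Rightarrow> nat set set \<Rightarrow> nat" where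
  "node_distance n G H = (LEAST m. (G, H) \<in> (\<Union>v\<in>{1..n}. rewiring n v) ^^ m)"

text \<open>Randomized algorithms are given by their output distributions, one for each input graph.\<close>

definition node_dp_algorithms ::
    "nat \<Rightarrow> real \<Rightarrow> nat \<Rightarrow> (nat set set \<Rightarrow> (nat \<times> nat \<Rightarrow> real) measure) set" where
  "node_dp_algorithms k \<epsilon> n = {\<A>.
     (\<forall>G\<in>graphs n. prob_space (\<A> G) \<and> sets (\<A> G) = sets (matrix_space k)) \<and>
     (\<forall>G\<in>graphs n. \<forall>H\<in>graphs n. \<forall>S\<in>sets (matrix_space k).
        measure (\<A> G) S \<le> exp (\<epsilon> * real (node_distance n G H)) * measure (\<A> H) S)}"

section \<open>The minimax rate\<close>

text \<open>Expectations are nonnegative extended integrals, since the risk of an algorithm may be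
  infinite; accordingly the minimum and the maximum are an infimum and a supremum in the extended
  nonnegative reals.\<close>

definition risk :: "nat \<Rightarrow> nat \<Rightarrow> (nat set set \<Rightarrow> (nat \<times> nat \<Rightarrow> real) measure) \<Rightarrow>
    (real \<Rightarrow> real \<Rightarrow> real) \<Rightarrow> ennreal" where
  "risk k n \<A> W = (\<integral>\<^sup>+ G. (\<integral>\<^sup>+ B. ennreal ((delta2_matrix k B W)\<^sup>2) \<partial>\<A> G) \<partial>random_graph n W)"

definition minimax_rate :: "nat \<Rightarrow> real \<Rightarrow> nat \<Rightarrow> ennreal" where
  "minimax_rate k \<epsilon> n =
     (INF \<A>\<in>node_dp_algorithms k \<epsilon> n. SUP W\<in>step_graphons k. risk k n \<A> W)"

end

theory Submission
  imports Defs
begin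

text \<open>Take \<open>W\<^sub>a = 1\<close> on \<open>[0,a]\<^sup>2\<close> and \<open>0\<close> elsewhere, with \<open>a = 1/2\<close> or
  \<open>a = 1/2 + \<delta>\<close>, where \<open>\<delta>\<close> is of order \<open>min 1 (1/(n\<epsilon>))\<close>. The random graph of \<open>W\<^sub>a\<close> is the clique
  on the vertices with label at most \<open>a\<close>. Coupling the two graphs through common labels, they differ
  by rewiring \<open>d\<close> vertices, where \<open>d\<close> has mean \<open>n\<delta> \<le> 1/(2\<epsilon>)\<close>. Privacy gives
  \<open>P\<^sub>1(E) + P\<^sub>2(-E) \<ge> exp (-\<epsilon>d) \<ge> 1 - \<epsilon>d\<close> for the two output distributions, so no test based on
  the output has error probabilities summing to less than \<open>1/2\<close>. On the other hand, an estimate that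
  is close to \<open>W\<^sub>a\<close> determines \<open>\<integral>W\<^sub>a = a\<^sup>2\<close>, hence tells the two graphons apart.\<close>

section \<open>Step functions on the unit square\<close>

lemma prob_space_unit_interval: "prob_space unit_interval"
  by (rule prob_spaceI) (simp add: emeasure_restrict_space)

interpretation unit: prob_space unit_interval
  by (rule prob_space_unit_interval)

interpretation unit_pair: pair_prob_space unit_interval unit_interval ..

abbreviation unit_square :: "(real \<times> real) measure" where
  "unit_square \<equiv> unit_interval \<Otimes>\<^sub>M unit_interval"

lemma borel_in_sets_unit_interval:
  assumes "A \<in> sets borel" "A \<subseteq> {0..1}"
  shows "A \<in> sets unit_interval"
  using assms by (auto simp: sets_restrict_space_iff)

lemma measure_unit_interval:
  assumes "A \<subseteq> {0..1}"
  shows "measure unit_interval A = measure lborel A"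
  using assms by (simp add: measure_restrict_space)

lemma mp_bijectionsD:
  assumes "\<phi> \<in> mp_bijections"
  shows "\<phi> \<in> unit_interval \<rightarrow>\<^sub>M unit_interval" "distr unit_interval unit_interval \<phi> = unit_interval"
  using assms by (auto simp: mp_bijections_def)

lemma id_in_mp_bijections: "(\<lambda>x. x) \<in> mp_bijections"
  by (auto simp: mp_bijections_def bij_betw_def distr_id)

text \<open>The integrand is the indicator of the rectangle formed by the preimages of
  \<open>A\<close> and \<open>B\<close> under \<open>\<phi>\<close>. As \<open>\<phi>\<close>
  preserves measure, these preimages have the measures of \<open>A\<close> and
  \<open>B\<close>.\<close>

lemma rectangle_integral:
  assumes [measurable]: "A \<in> sets unit_interval" "B \<in> sets unit_interval"
    and \<phi>: "\<phi> \<in> mp_bijections"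
  shows "integrable unit_square
      (\<lambda>z. indicator A (\<phi> (fst z)) * indicator B (\<phi> (snd z)) :: real)" (is ?int)
    and "(LINT z|unit_square. indicator A (\<phi> (fst z)) * indicator B (\<phi> (snd z)))
      = measure unit_interval A * measure unit_interval B" (is ?eq)
proof -
  note [measurable] = mp_bijectionsD(1)[OF \<phi>]
  show ?int
    by (rule unit_pair.P.integrable_const_bound[of _ 1]) (auto simp: indicator_def)
  define A' where "A' = \<phi> -` A \<inter> space unit_interval"
  define B' where "B' = \<phi> -` B \<inter> space unit_interval"
  have [measurable]: "A' \<in> sets unit_interval" "B' \<in> sets unit_interval"
    unfolding A'_def B'_def by measurable
  have m: "measure unit_interval A' = measure unit_interval A"
    "measure unit_interval B' = measure unit_interval B"
    using measure_distr[of \<phi> unit_interval unit_interval A]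
      measure_distr[of \<phi> unit_interval unit_interval B] mp_bijectionsD[OF \<phi>]
    by (auto simp: A'_def B'_def)
  have "(LINT z|unit_square.
      indicator A (\<phi> (fst z)) * indicator B (\<phi> (snd z)) :: real)
    = (LINT z|unit_square. indicator (A' \<times> B') z)"
    by (rule Bochner_Integration.integral_cong)
      (auto simp: A'_def B'_def space_pair_measure indicator_def)
  also have "\<dots> = measure unit_square (A' \<times> B')"
    by (simp add: Int_absorb2 sets.sets_into_space)
  also have "\<dots> = measure unit_interval A' * measure unit_interval B'"
    by (simp add: measure_def unit.emeasure_pair_measure_Times enn2real_mult)
  finally show ?eq
    by (simp add: m)
qed

lemma (in prob_space) expectation_square_ge:
  fixes X :: "'a \<Rightarrow> real"
  assumes "integrable M X" "integrable M (\<lambda>x. (X x)\<^sup>2)"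
  shows "(expectation X)\<^sup>2 \<le> expectation (\<lambda>x. (X x)\<^sup>2)"
  using variance_eq[OF assms] variance_positive[of X] by linarith

text \<open>The integral of the step function given by \<open>B\<close>. Block lengths stay
  unevaluated measures instead of 1/k, so that the terms match
  \<open>rectangle_integral\<close>.\<close>

definition block_mean :: "nat \<Rightarrow> (nat \<times> nat \<Rightarrow> real) \<Rightarrow> real" where
  "block_mean k B = (\<Sum>i\<in>{1..k}. \<Sum>j\<in>{1..k}. B (i, j) *
     (measure unit_interval (equal_block k i) * measure unit_interval (equal_block k j)))"

lemma equal_block_sets [measurable]:
  assumes "i \<in> {1..k}"
  shows "equal_block k i \<in> sets unit_interval"
proof (rule borel_in_sets_unit_interval)
  have "0 \<le> (real i - 1) / real k" "real i / real k \<le> 1"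
    using assms by auto
  then have "{(real i - 1) / real k..real i / real k} \<subseteq> {0..1}"
    by (simp only: atLeastatMost_subset_iff simp_thms)
  moreover have "equal_block k i \<subseteq> {(real i - 1) / real k..real i / real k}"
    by (auto simp only: equal_block_def split: if_splits) simp_all
  ultimately show "equal_block k i \<subseteq> {0..1}"
    by blast
qed (simp add: equal_block_def)

lemma block_mean_measurable [measurable]: "block_mean k \<in> borel_measurable (matrix_space k)"
  unfolding block_mean_def by measurable

lemma graphon_of_matrix_integral:
  assumes "\<phi> \<in> mp_bijections"
  shows "integrable unit_square
      (\<lambda>z. graphon_of_matrix k B (\<phi> (fst z)) (\<phi> (snd z)))"
    and "(LINT z|unit_square. graphon_of_matrix k B (\<phi> (fst z)) (\<phi> (snd z)))
      = block_mean k B"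
proof -
  note R = rectangle_integral[OF equal_block_sets equal_block_sets assms]
  show "integrable unit_square (\<lambda>z. graphon_of_matrix k B (\<phi> (fst z)) (\<phi> (snd z)))"
    unfolding graphon_of_matrix_def mult.assoc
    by (intro Bochner_Integration.integrable_sum integrable_mult_right R)
  show "(LINT z|unit_square. graphon_of_matrix k B (\<phi> (fst z)) (\<phi> (snd z))) = block_mean k B"
    unfolding graphon_of_matrix_def block_mean_def mult.assoc
    by (subst Bochner_Integration.integral_sum,
        intro Bochner_Integration.integrable_sum integrable_mult_right R,
        assumption, assumption, intro sum.cong refl,
        subst Bochner_Integration.integral_sum,
        intro integrable_mult_right R,
        assumption, assumption, intro sum.cong refl)
      (simp only: integral_mult_right_zero R(2))
qed

section \<open>Clique graphons and a lower bound for their distance from a matrix\<close>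

definition clique_graphon :: "real \<Rightarrow> real \<Rightarrow> real \<Rightarrow> real" where
  "clique_graphon a x y = (if x \<le> a \<and> y \<le> a then 1 else 0)"

lemma clique_graphon_integral:
  assumes "0 \<le> a" "a \<le> 1"
  shows "integrable unit_square (\<lambda>z. clique_graphon a (fst z) (snd z))"
    and "(LINT z|unit_square. clique_graphon a (fst z) (snd z)) = a\<^sup>2"
proof -
  have A: "{0..a} \<in> sets unit_interval"
    using assms by (intro borel_in_sets_unit_interval) auto
  have eq: "clique_graphon a (fst z) (snd z) = indicator {0..a} (fst z) * indicator {0..a} (snd z)"
    if "z \<in> space unit_square" for z
    using that by (auto simp: clique_graphon_def space_pair_measure indicator_def)
  note R = rectangle_integral[OF A A id_in_mp_bijections]
  show "integrable unit_square (\<lambda>z. clique_graphon a (fst z) (snd z))"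
    using R(1) by (subst Bochner_Integration.integrable_cong[OF refl eq]) auto
  show "(LINT z|unit_square. clique_graphon a (fst z) (snd z)) = a\<^sup>2"
    using R(2) assms
    by (subst Bochner_Integration.integral_cong[OF refl eq])
      (auto simp: measure_unit_interval power2_eq_square)
qed

text \<open>Serves to show square integrability: on a probability space a bound uniform in the point
  suffices.\<close>

lemma graphon_of_matrix_bounded: "\<bar>graphon_of_matrix k B x y\<bar> \<le> (\<Sum>i\<in>{1..k}. \<Sum>j\<in>{1..k}. \<bar>B (i, j)\<bar>)"
  unfolding graphon_of_matrix_def
  by (intro order_trans[OF sum_abs] sum_mono order_trans[OF sum_abs])
    (auto simp: indicator_def)

text \<open>The integral of a graphon is invariant under measure-preserving bijections, so it gives a
  lower bound for \<open>\<delta>\<^sub>2\<close> that does not involve the infimum.\<close>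

lemma delta2_matrix_clique_graphon_ge:
  assumes "0 \<le> a" "a \<le> 1"
  shows "\<bar>block_mean k B - a\<^sup>2\<bar> \<le> delta2_matrix k B (clique_graphon a)"
  unfolding delta2_matrix_def delta2_def
proof (rule cINF_greatest)
  show "mp_bijections \<noteq> {}"
    using id_in_mp_bijections by blast
  fix \<phi> assume \<phi>: "\<phi> \<in> mp_bijections"
  define X where "X z = graphon_of_matrix k B (\<phi> (fst z)) (\<phi> (snd z)) -
    clique_graphon a (fst z) (snd z)" for z
  note int = graphon_of_matrix_integral[OF \<phi>, of k B] clique_graphon_integral[OF assms]
  have X: "integrable unit_square X"
    unfolding X_def using int by (intro Bochner_Integration.integrable_diff)
  then have [measurable]: "X \<in> borel_measurable unit_square"
    by (rule borel_measurable_integrable)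
  define C where "C = (\<Sum>i\<in>{1..k}. \<Sum>j\<in>{1..k}. \<bar>B (i, j)\<bar>) + 1"
  have "\<bar>X z\<bar> \<le> C" for z
    using graphon_of_matrix_bounded[of k B "\<phi> (fst z)" "\<phi> (snd z)"]
    unfolding X_def C_def clique_graphon_def by (auto simp del: One_nat_def)
  then have "(X z)\<^sup>2 \<le> C\<^sup>2" for z
    by (metis abs_ge_zero power2_abs power_mono)
  then have X2: "integrable unit_square (\<lambda>z. (X z)\<^sup>2)"
    by (intro unit_pair.P.integrable_const_bound[of _ "C\<^sup>2"]) auto
  have "(block_mean k B - a\<^sup>2)\<^sup>2 = (unit_pair.P.expectation X)\<^sup>2"
    using int by (simp add: X_def[abs_def])
  \<comment> \<open>Nonnegativity of the variance bounds the L2 norm from below by the absolute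
    value of the mean.\<close>
  also have "\<dots> \<le> unit_pair.P.expectation (\<lambda>z. (X z)\<^sup>2)"
    by (rule unit_pair.P.expectation_square_ge[OF X X2])
  finally have "\<bar>block_mean k B - a\<^sup>2\<bar> \<le> sqrt (unit_pair.P.expectation (\<lambda>z. (X z)\<^sup>2))"
    using real_le_rsqrt by fastforce
  then show "\<bar>block_mean k B - a\<^sup>2\<bar> \<le> L2_norm_graphon
      (\<lambda>x y. graphon_of_matrix k B (\<phi> x) (\<phi> y) - clique_graphon a x y)"
    by (simp add: L2_norm_graphon_def X_def case_prod_unfold)
qed

section \<open>Clique graphons are step graphons\<close>

lemma UN_adjacent_intervals:
  fixes c :: "nat \<Rightarrow> real"
  assumes "\<And>i j. i \<le> j \<Longrightarrow> c i \<le> c j" and "1 \<le> k"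
  shows "(\<Union>i\<in>{1..k}. if i = 1 then {c 0..c 1} else {c (i - 1)<..c i}) = {c 0..c k}"
  using \<open>1 \<le> k\<close>
proof (induction k rule: dec_induct)
  case base
  then show ?case by simp
next
  case (step k)
  have "{c 0..c k} \<union> {c k<..c (Suc k)} = {c 0..c (Suc k)}"
    using assms(1)[of 0 k] assms(1)[of k "Suc k"] by (auto intro: order_trans)
  with step show ?case
    by (simp add: atLeastAtMostSuc_conv Un_commute)
qed

text \<open>Used with \<open>w\<close> the length of one side of the cut at \<open>a\<close>,
  \<open>p\<close> the number of equal pieces of that side and \<open>q\<close> the total number of
  pieces. As \<open>p\<close> lies between q/3 and q, the quotient lies between 1/(4q) and
  9/(4q).\<close>

lemma step_length_bounds:
  fixes w p q :: real
  assumes "1 / 4 \<le> w" "w \<le> 3 / 4" "0 < p" "p \<le> q" "q \<le> 3 * p"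
  shows "w / p \<in> {1 / (4 * q)..4 / q}"
proof -
  have "q * (1 / 4) \<le> q * w" "q * w \<le> q * (3 / 4)"
    using assms by (intro mult_left_mono; simp)+
  then have "p \<le> 4 * (q * w)" "q * w \<le> 4 * p"
    using assms by linarith+
  then show ?thesis
    using assms by (simp add: field_simps)
qed

lemma clique_graphon_in_step_graphons:
  assumes "2 \<le> k" "1 / 4 \<le> a" "a \<le> 3 / 4"
  shows "clique_graphon a \<in> step_graphons k"
proof -
  \<comment> \<open>With k/2 rounded down, both sides of \<open>a\<close> still receive at least k/3
    pieces; k = 3 is the extreme case.\<close>
  define m where "m = k div 2"
  have "1 \<le> m" "m < k" "k \<le> 3 * m" "2 * m \<le> k"
    using assms(1) by (auto simp: m_def)
  then have m: "1 \<le> m" "m < k" "real k \<le> 3 * real m" "2 * real m \<le> real k"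
    by linarith+
  define s where "s = a / real m"
  define t where "t = (1 - a) / real (k - m)"
  have st: "s \<in> {1 / (4 * real k)..4 / real k}" "t \<in> {1 / (4 * real k)..4 / real k}"
    unfolding s_def t_def using assms m by (intro step_length_bounds; simp add: of_nat_diff)+
  have pos: "0 < s" "0 < t"
    using assms m by (auto simp: s_def t_def)
  \<comment> \<open>The breakpoints: \<open>m\<close> steps of length \<open>s\<close> lead from 0
    to \<open>a\<close>, the remaining steps of length \<open>t\<close> lead on to 1.\<close>
  define c where "c i = (if i \<le> m then real i * s else a + (real i - real m) * t)" for i
  have ms: "real m * s = a" and ct: "(real k - real m) * t = 1 - a"
    using m by (auto simp: s_def t_def of_nat_diff)
  have c_Suc: "c (Suc i) = c i + (if i < m then s else t)" for i
    using ms by (cases "i = m") (auto simp: c_def algebra_simps)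
  have c_less: "c i < c (Suc i)" for i
    using pos by (simp add: c_Suc)
  then have c_mono: "c i \<le> c j" if "i \<le> j" for i j
    using that by (simp add: lift_Suc_mono_le less_imp_le)
  have c0: "c 0 = 0" and cm: "c m = a" and ck: "c k = 1"
    using ms ct m by (auto simp: c_def)
  \<comment> \<open>Pieces are closed on the right, so the point \<open>a\<close> lies in piece
    \<open>m\<close>, in agreement with the weak inequalities in \<open>clique_graphon\<close>. The
    first piece also contains 0.\<close>
  define I where "I i = (if i = 1 then {c 0..c 1} else {c (i - 1)<..c i})" for i
  have I_upper: "x \<le> c i" if "x \<in> I i" for x i
    using that by (auto simp: I_def split: if_splits)
  have I_lower: "c (i - 1) < x" if "x \<in> I i" "1 < i" for x i
    using that by (auto simp: I_def)
  have partition: "interval_partition k I"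
    unfolding interval_partition_def
  proof (intro conjI ballI impI)
    show "is_interval (I i)" for i
      by (simp add: I_def is_interval_cc is_interval_oc)
    show "(\<Union>i\<in>{1..k}. I i) = {0..1}"
      using UN_adjacent_intervals[of c k] c_mono assms(1) by (simp add: I_def c0 ck)
    show "x < y" if "i \<in> {1..k}" "i < j" "x \<in> I i" "y \<in> I j" for i j x y
    proof -
      have "x \<le> c i" "c (j - 1) < y"
        using that I_upper[of x i] I_lower[of y j] by auto
      moreover have "c i \<le> c (j - 1)"
        using that by (intro c_mono) auto
      ultimately show ?thesis by linarith
    qed
  qed
  have lengths: "measure lborel (I i) \<in> {1 / (4 * real k)..4 / real k}" if "i \<in> {1..k}" for i
  proof -
    have "measure lborel (I i) = c i - c (i - 1)"
      using c_mono[of "i - 1" i] by (auto simp: I_def)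
    also have "\<dots> = (if i - 1 < m then s else t)"
      using c_Suc[of "i - 1"] that by simp
    finally show ?thesis
      using st by simp
  qed
  have I_iff: "x \<le> a \<longleftrightarrow> i \<le> m" if "i \<in> {1..k}" "x \<in> I i" for x i
  proof (cases "i \<le> m")
    case True
    then show ?thesis
      using I_upper[OF that(2)] c_mono[OF True] cm by simp
  next
    case False
    then have "a < x"
      using I_lower[OF that(2)] c_mono[of m "i - 1"] cm m by fastforce
    with False show ?thesis by simp
  qed
  define A :: "nat \<Rightarrow> nat \<Rightarrow> real" where "A i j = (if i \<le> m \<and> j \<le> m then 1 else 0)" for i j
  have "clique_graphon a x y = A i j"
    if "i \<in> {1..k}" "j \<in> {1..k}" "x \<in> I i" "y \<in> I j" for i j x y
    using I_iff[OF that(1,3)] I_iff[OF that(2,4)] by (simp add: clique_graphon_def A_def)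
  moreover have "graphon (clique_graphon a)"
    using clique_graphon_integral(1)[of a] assms borel_measurable_integrable
    by (auto simp: graphon_def clique_graphon_def case_prod_unfold intro!: exI[of _ 1])
  moreover have "clique_graphon a x y \<le> 1" "0 \<le> A i j" for x y i j
    by (simp_all add: clique_graphon_def A_def)
  ultimately show ?thesis
    using partition lengths unfolding step_graphons_def by blast
qed

section \<open>Cliques on random vertex sets\<close>

definition clique :: "nat set \<Rightarrow> nat set set" where
  "clique S = {e. e \<subseteq> S \<and> card e = 2}"

lemma clique_in_graphs: "S \<subseteq> {1..n} \<Longrightarrow> clique S \<in> graphs n"
  by (auto simp: clique_def graphs_def)

text \<open>Deleting all edges at \<open>v\<close> is a single rewiring and turns a clique into the
  clique on the remaining vertices; the induction does this for the vertices of \<open>D\<close> one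
  by one.\<close>

lemma clique_remove_vertices:
  assumes "finite D" "D \<subseteq> T" "T \<subseteq> {1..n}"
  shows "(clique T, clique (T - D)) \<in> (\<Union>v\<in>{1..n}. rewiring n v) ^^ card D"
  using assms
proof (induction D rule: finite_induct)
  case empty
  then show ?case by simp
next
  case (insert v D)
  have "(clique (T - D), clique (T - insert v D)) \<in> rewiring n v"
    using insert.prems by (auto simp: rewiring_def clique_in_graphs clique_def graphs_def)
  with insert show ?case
    by (auto intro!: relcompI)
qed

lemma node_distance_clique_le:
  assumes "S \<subseteq> T" "T \<subseteq> {1..n}"
  shows "node_distance n (clique T) (clique S) \<le> card (T - S)"
proof -
  have "finite (T - S)"
    using assms(2) finite_subset by blast
  from clique_remove_vertices[OF this _ assms(2)] assms(1)
  have "(clique T, clique S) \<in> (\<Union>v\<in>{1..n}. rewiring n v) ^^ card (T - S)"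
    by (simp add: double_diff)
  then show ?thesis
    unfolding node_distance_def by (rule Least_le)
qed

section \<open>Random labels and the vertices below a threshold\<close>

abbreviation labels :: "nat \<Rightarrow> (nat \<Rightarrow> real) measure" where
  "labels n \<equiv> \<Pi>\<^sub>M i\<in>{1..n}. unit_interval"

text \<open>Taking two thresholds with the same \<open>x\<close> is the coupling of the two random
  graphs: for a \<le> b the vertex sets are nested.\<close>

definition below :: "nat \<Rightarrow> real \<Rightarrow> (nat \<Rightarrow> real) \<Rightarrow> nat set" where
  "below n a x = {i\<in>{1..n}. x i \<le> a}"

lemma bernoulli_pmf_of_bool: "bernoulli_pmf (of_bool P) = return_pmf P"
proof (rule pmf_eqI)
  fix i show "pmf (bernoulli_pmf (of_bool P)) i = pmf (return_pmf P) i"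
    by (cases P; cases i) simp_all
qed

text \<open>All edge probabilities are 0 or 1, so the graph is determined by the labels.\<close>

lemma random_graph_of_labels_clique_graphon:
  "random_graph_of_labels n (clique_graphon a) x = return_pmf (clique (below n a x))"
proof -
  have fin: "finite (vertex_pairs n)"
    by (rule finite_subset[of _ "{1..n} \<times> {1..n}"]) (auto simp: vertex_pairs_def)
  have "(\<lambda>(i, j). bernoulli_pmf (clique_graphon a (x i) (x j)))
    = (\<lambda>p. return_pmf (x (fst p) \<le> a \<and> x (snd p) \<le> a))"
    by (auto simp: clique_graphon_def fun_eq_iff simp flip: bernoulli_pmf_of_bool)
  then have "random_graph_of_labels n (clique_graphon a) x = return_pmf
      {{i, j} | i j. (i, j) \<in> vertex_pairs n \<and> x i \<le> a \<and> x j \<le> a}"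
    using fin unfolding random_graph_of_labels_def
    by (auto simp: intro!: arg_cong[of _ _ return_pmf])
  moreover have "{{i, j} | i j. (i, j) \<in> vertex_pairs n \<and> x i \<le> a \<and> x j \<le> a}
    = clique (below n a x)"
  proof (intro equalityI subsetI)
    fix e assume "e \<in> clique (below n a x)"
    then obtain i j where e: "e = {i, j}" "i \<noteq> j" "{i, j} \<subseteq> below n a x"
      by (auto simp: clique_def card_2_iff)
    show "e \<in> {{i, j} | i j. (i, j) \<in> vertex_pairs n \<and> x i \<le> a \<and> x j \<le> a}"
    \<comment> \<open>Edges are unordered, but \<open>vertex_pairs\<close> lists the smaller
      endpoint first, so the two endpoints may have to be swapped.\<close>
    proof (cases "i < j")
      case True
      with e show ?thesis
        by (auto simp: below_def vertex_pairs_def)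
    next
      case False
      with e have "e = {j, i} \<and> (j, i) \<in> vertex_pairs n \<and> x j \<le> a \<and> x i \<le> a"
        by (auto simp: below_def vertex_pairs_def)
      then show ?thesis by blast
    qed
  qed (auto simp: clique_def below_def vertex_pairs_def)
  ultimately show ?thesis by simp
qed

text \<open>There are finitely many values, and each is attained on a set described by finitely many
  conditions on single coordinates.\<close>

lemma below_measurable [measurable]: "below n a \<in> labels n \<rightarrow>\<^sub>M count_space UNIV"
proof -
  have "below n a -` {S} \<inter> space (labels n) \<in> sets (labels n)" if "S \<subseteq> {1..n}" for S
  proof -
    have "below n a -` {S} \<inter> space (labels n)
      = {x \<in> space (labels n). \<forall>i\<in>{1..n}. i \<in> S \<longleftrightarrow> x i \<le> a}"
      using that unfolding below_def by blast
    also have "\<dots> \<in> sets (labels n)"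
    proof (rule sets.sets_Collect_finite_All)
      fix i assume "i \<in> {1..n}"
      then have [measurable]: "(\<lambda>x. x i) \<in> borel_measurable (labels n)"
        by (intro measurable_compose[OF measurable_component_singleton] measurable_restrict_space1) auto
      show "{x \<in> space (labels n). i \<in> S \<longleftrightarrow> x i \<le> a} \<in> sets (labels n)"
        by (cases "i \<in> S"; simp only: simp_thms; measurable)
    qed simp
    finally show ?thesis .
  qed
  moreover have "below n a x \<in> Pow {1..n}" for x
    by (auto simp: below_def)
  ultimately have "below n a \<in> labels n \<rightarrow>\<^sub>M count_space (Pow {1..n})"
    by (subst measurable_count_space_eq2) (simp_all del: One_nat_def)
  then show ?thesis
    by (rule measurable_compose) simp
qed

text \<open>The values of \<open>below\<close> live in a discrete space, so \<open>f\<close> is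
  arbitrary. This covers the output distributions of an algorithm as functions of the
  labels.\<close>

lemma function_of_below_measurable:
  assumes "space N = UNIV"
  shows "(\<lambda>x. f (below n a x)) \<in> labels n \<rightarrow>\<^sub>M N"
  by (rule measurable_compose[OF below_measurable]) (simp add: assms)

lemma prob_space_labels: "prob_space (labels n)"
  by (intro prob_space_PiM prob_space_unit_interval)

lemma random_graph_clique_graphon:
  "random_graph n (clique_graphon a) = distr (labels n) (count_space UNIV) (\<lambda>x. clique (below n a x))"
proof -
  have "random_graph n (clique_graphon a)
    = labels n \<bind> (\<lambda>x. return (count_space UNIV) (clique (below n a x)))"
    by (simp add: random_graph_def random_graph_of_labels_clique_graphon return_pmf.rep_eq)
  also have "\<dots> = distr (labels n) (count_space UNIV) (\<lambda>x. clique (below n a x))"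
    using prob_space.not_empty[OF prob_space_labels]
    by (intro bind_return_distr' function_of_below_measurable) auto
  finally show ?thesis .
qed

text \<open>The sum of indicators gives both the measurability of the count and, by linearity, its
  mean.\<close>

lemma number_between:
  "ennreal (real (card (below n b x - below n a x))) = (\<Sum>i\<in>{1..n}. indicator {a<..b} (x i))"
proof -
  have "below n b x - below n a x = {i\<in>{1..n}. x i \<in> {a<..b}}"
    by (auto simp: below_def)
  then have "real (card (below n b x - below n a x)) = (\<Sum>i\<in>{1..n}. indicator {a<..b} (x i))"
    by (simp add: indicator_def sum.If_cases Int_def)
  then show ?thesis
    by (simp add: ennreal_indicator flip: sum_ennreal)
qed

lemma Ioc_in_sets_unit_interval:
  fixes a b :: real
  assumes "0 \<le> a" "b \<le> 1"
  shows "{a<..b} \<in> sets unit_interval"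
  using assms by (intro borel_in_sets_unit_interval) auto

lemma expected_number_between:
  assumes "0 \<le> a" "a \<le> b" "b \<le> 1"
  shows "(\<integral>\<^sup>+x. ennreal (real (card (below n b x - below n a x))) \<partial>labels n) = ennreal (real n * (b - a))"
proof -
  note [measurable] = Ioc_in_sets_unit_interval[OF assms(1,3)]
  have "(\<integral>\<^sup>+x. ennreal (real (card (below n b x - below n a x))) \<partial>labels n)
    = (\<Sum>i\<in>{1..n}. \<integral>\<^sup>+x. indicator {a<..b} (x i) \<partial>labels n)"
    by (simp add: number_between nn_integral_sum)
  also have "\<dots> = (\<Sum>i\<in>{1..n}. ennreal (b - a))"
  proof (rule sum.cong)
    fix i assume i: "i \<in> {1..n}"
    \<comment> \<open>Passes to the marginal of coordinate \<open>i\<close>, which is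
      uniform.\<close>
    have "(\<integral>\<^sup>+x. indicator {a<..b} (x i) \<partial>labels n)
      = (\<integral>\<^sup>+u. indicator {a<..b} u \<partial>distr (labels n) unit_interval (\<lambda>x. x i))"
      using i by (subst nn_integral_distr) auto
    also have "\<dots> = (\<integral>\<^sup>+u. indicator {a<..b} u \<partial>unit_interval)"
      using i by (subst distr_PiM_component) (auto intro: prob_space_unit_interval)
    also have "\<dots> = emeasure unit_interval {a<..b}"
      by simp
    also have "\<dots> = ennreal (b - a)"
      using assms by (simp add: emeasure_restrict_space subset_eq)
    finally show "(\<integral>\<^sup>+x. indicator {a<..b} (x i) \<partial>labels n) = ennreal (b - a)" .
  qed simp
  also have "\<dots> = ennreal (real n * (b - a))"
    using assms by (simp add: ennreal_mult ennreal_of_nat_eq_real_of_nat)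
  finally show ?thesis .
qed

section \<open>The two-point argument\<close>

text \<open>A Markov-type bound: for outputs in \<open>E\<close> the mean of the matrix is off by at
  least \<open>\<eta>\<close>, hence so is \<open>\<delta>\<close>_2. In the application
  \<open>E\<close> is the event that a test rejects the true threshold.\<close>

lemma risk_clique_graphon_ge:
  assumes "\<And>G. G \<in> graphs n \<Longrightarrow> sets (\<A> G) = sets (matrix_space k)"
    and "E \<in> sets (matrix_space k)" and "0 \<le> a" "a \<le> 1" "0 \<le> \<eta>"
    and "\<And>B. B \<in> E \<Longrightarrow> \<eta> \<le> \<bar>block_mean k B - a\<^sup>2\<bar>"
  shows "ennreal (\<eta>\<^sup>2) * (\<integral>\<^sup>+x. emeasure (\<A> (clique (below n a x))) E \<partial>labels n)
    \<le> risk k n \<A> (clique_graphon a)"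
proof -
  define L where "L G = (\<integral>\<^sup>+ B. ennreal ((delta2_matrix k B (clique_graphon a))\<^sup>2) \<partial>\<A> G)" for G
  have "ennreal (\<eta>\<^sup>2) * (\<integral>\<^sup>+x. emeasure (\<A> (clique (below n a x))) E \<partial>labels n)
    = (\<integral>\<^sup>+x. ennreal (\<eta>\<^sup>2) * emeasure (\<A> (clique (below n a x))) E \<partial>labels n)"
    by (intro nn_integral_cmult[symmetric] function_of_below_measurable) simp
  also have "\<dots> \<le> (\<integral>\<^sup>+x. L (clique (below n a x)) \<partial>labels n)"
  proof (rule nn_integral_mono)
    fix x
    let ?G = "clique (below n a x)"
    have "?G \<in> graphs n"
      by (rule clique_in_graphs) (auto simp: below_def)
    then have E: "E \<in> sets (\<A> ?G)"
      using assms by simp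
    have "ennreal (\<eta>\<^sup>2) * indicator E B \<le> ennreal ((delta2_matrix k B (clique_graphon a))\<^sup>2)" for B
    proof (cases "B \<in> E")
      case True
      then have "\<eta> \<le> delta2_matrix k B (clique_graphon a)"
        using assms(6)[of B] delta2_matrix_clique_graphon_ge[OF assms(3,4), of k B] by linarith
      with \<open>0 \<le> \<eta>\<close> True show ?thesis
        by (simp add: power_mono ennreal_leI)
    qed simp
    then have "(\<integral>\<^sup>+B. ennreal (\<eta>\<^sup>2) * indicator E B \<partial>\<A> ?G) \<le> L ?G"
      unfolding L_def by (intro nn_integral_mono)
    then show "ennreal (\<eta>\<^sup>2) * emeasure (\<A> ?G) E \<le> L ?G"
      by (simp add: nn_integral_cmult_indicator[OF E])
  qed
  also have "\<dots> = risk k n \<A> (clique_graphon a)"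
    unfolding risk_def random_graph_clique_graphon L_def[symmetric]
    by (subst nn_integral_distr) (simp_all add: function_of_below_measurable del: One_nat_def)
  finally show ?thesis .
qed

text \<open>Privacy carries the mass of \<open>E\<close> from \<open>T\<close> to \<open>S\<close>
  at the cost of a factor exp(-d), with d standing for \<open>?d\<close>. Replacing this factor by 1
  - d makes the loss linear in the number of rewired vertices, so that its average over the labels
  depends only on the expected number.\<close>

lemma dp_events_ge:
  assumes \<A>: "\<A> \<in> node_dp_algorithms k \<epsilon> n" and "0 < \<epsilon>"
    and E: "E \<in> sets (matrix_space k)" and ST: "S \<subseteq> T" "T \<subseteq> {1..n}"
  shows "1 \<le> emeasure (\<A> (clique S)) E + emeasure (\<A> (clique T)) (space (matrix_space k) - E)
    + ennreal \<epsilon> * ennreal (real (card (T - S)))"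
proof -
  let ?d = "\<epsilon> * real (card (T - S))"
  have G: "clique S \<in> graphs n" "clique T \<in> graphs n"
    using ST by (intro clique_in_graphs; blast)+
  interpret S: prob_space "\<A> (clique S)"
    using \<A> G by (auto simp: node_dp_algorithms_def)
  interpret T: prob_space "\<A> (clique T)"
    using \<A> G by (auto simp: node_dp_algorithms_def)
  have sets: "sets (\<A> (clique T)) = sets (matrix_space k)"
    using \<A> G by (auto simp: node_dp_algorithms_def)
  have "T.prob E \<le> exp (\<epsilon> * real (node_distance n (clique T) (clique S))) * S.prob E"
    using \<A> G E by (auto simp: node_dp_algorithms_def)
  also have "\<dots> \<le> exp ?d * S.prob E"
    using node_distance_clique_le[OF ST] \<open>0 < \<epsilon>\<close> by (intro mult_right_mono) auto
  finally have "exp (- ?d) * T.prob E \<le> S.prob E"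
    by (simp add: exp_minus field_simps)
  \<comment> \<open>The left factor may be negative; the inequality survives because the probability
    is nonnegative.\<close>
  moreover have "(1 - ?d) * T.prob E \<le> exp (- ?d) * T.prob E"
    using exp_ge_add_one_self[of "- ?d"] by (intro mult_right_mono) auto
  moreover have "?d * T.prob E \<le> ?d * 1"
    using \<open>0 < \<epsilon>\<close> by (intro mult_left_mono) auto
  moreover have "T.prob (space (matrix_space k) - E) = 1 - T.prob E"
    using T.prob_compl[of E] E sets sets_eq_imp_space_eq[OF sets] by simp
  ultimately have "1 \<le> S.prob E + T.prob (space (matrix_space k) - E) + ?d"
    by (simp add: algebra_simps)
  then have "ennreal 1 \<le> ennreal (S.prob E + T.prob (space (matrix_space k) - E) + ?d)"
    by (rule ennreal_leI)
  also have "\<dots> = ennreal (S.prob E) + ennreal (T.prob (space (matrix_space k) - E))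
      + ennreal \<epsilon> * ennreal (real (card (T - S)))"
    using \<open>0 < \<epsilon>\<close> by (simp add: ennreal_plus ennreal_mult)
  finally show ?thesis
    by (simp only: S.emeasure_eq_measure T.emeasure_eq_measure ennreal_1)
qed

lemma two_point_bound:
  assumes \<A>: "\<A> \<in> node_dp_algorithms k \<epsilon> n" and "0 < \<epsilon>"
    and ab: "0 \<le> a" "a \<le> b" "b \<le> 1" "\<epsilon> * (real n * (b - a)) \<le> 1 / 2"
  shows "ennreal (((b\<^sup>2 - a\<^sup>2) / 2)\<^sup>2 / 2)
    \<le> risk k n \<A> (clique_graphon a) + risk k n \<A> (clique_graphon b)"
proof -
  \<comment> \<open>The test decides for \<open>b\<close> on \<open>E\<close> and for
    \<open>a\<close> on \<open>F\<close>. Its threshold is the midpoint of the two integrals, so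
    either error means a deviation of at least half their difference, which is
    \<open>\<eta>\<close>.\<close>
  define E where "E = {B \<in> space (matrix_space k). (a\<^sup>2 + b\<^sup>2) / 2 \<le> block_mean k B}"
  define F where "F = space (matrix_space k) - E"
  define \<eta> where "\<eta> = (b\<^sup>2 - a\<^sup>2) / 2"
  have E [measurable]: "E \<in> sets (matrix_space k)"
    unfolding E_def by measurable
  then have F [measurable]: "F \<in> sets (matrix_space k)"
    unfolding F_def by measurable
  have "0 \<le> \<eta>"
    using ab by (simp add: \<eta>_def power_mono)
  have far: "\<eta> \<le> \<bar>block_mean k B - a\<^sup>2\<bar>" if "B \<in> E" for B
  proof -
    have "(a\<^sup>2 + b\<^sup>2) / 2 \<le> block_mean k B"
      using that by (simp add: E_def)
    then show ?thesis
      unfolding \<eta>_def by argo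
  qed
  have far': "\<eta> \<le> \<bar>block_mean k B - b\<^sup>2\<bar>" if "B \<in> F" for B
  proof -
    have "block_mean k B < (a\<^sup>2 + b\<^sup>2) / 2"
      using that by (auto simp: E_def F_def)
    then show ?thesis
      unfolding \<eta>_def by argo
  qed
  have sets: "sets (\<A> G) = sets (matrix_space k)" if "G \<in> graphs n" for G
    using \<A> that by (auto simp: node_dp_algorithms_def)
  define P where "P = (\<integral>\<^sup>+x. emeasure (\<A> (clique (below n a x))) E \<partial>labels n)"
  define Q where "Q = (\<integral>\<^sup>+x. emeasure (\<A> (clique (below n b x))) F \<partial>labels n)"
  note [measurable] = Ioc_in_sets_unit_interval[OF ab(1,3)]
  have [measurable]: "(\<lambda>x. emeasure (\<A> (clique (below n c x))) H) \<in> borel_measurable (labels n)"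
    for c H
    by (rule function_of_below_measurable) simp
  have [measurable]:
    "(\<lambda>x. ennreal (real (card (below n b x - below n a x)))) \<in> borel_measurable (labels n)"
    unfolding number_between by measurable
  have "1 = (\<integral>\<^sup>+x. 1 \<partial>labels n)"
    by (simp add: prob_space.emeasure_space_1[OF prob_space_labels] del: One_nat_def)
  \<comment> \<open>The privacy bound holds for every label vector separately, with S and T the
    nested sets \<open>below n a x\<close> and \<open>below n b x\<close>.\<close>
  also have "\<dots> \<le> (\<integral>\<^sup>+x. emeasure (\<A> (clique (below n a x))) E + emeasure (\<A> (clique (below n b x))) F
      + ennreal \<epsilon> * ennreal (real (card (below n b x - below n a x))) \<partial>labels n)"
    unfolding F_def using ab
    by (intro nn_integral_mono dp_events_ge[OF \<A> \<open>0 < \<epsilon>\<close> E]) (auto simp: below_def)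
  also have "\<dots> = P + Q + ennreal \<epsilon> * ennreal (real n * (b - a))"
    unfolding P_def Q_def expected_number_between[OF ab(1-3), symmetric]
    by (subst nn_integral_add, measurable, subst nn_integral_add, measurable,
        subst nn_integral_cmult, measurable)
  also have "\<dots> \<le> P + Q + ennreal (1 / 2)"
    using ab(2) ennreal_leI[OF ab(4)] \<open>0 < \<epsilon>\<close> by (intro add_left_mono) (simp add: ennreal_mult)
  \<comment> \<open>Rewrites the left end of the chain, so that a finite summand 1/2 can be
    cancelled in \<open>ennreal\<close>.\<close>
  also have "1 = ennreal (1 / 2) + ennreal (1 / 2)"
    by (subst ennreal_plus[symmetric]) simp_all
  finally have "ennreal (1 / 2) + ennreal (1 / 2) \<le> ennreal (1 / 2) + (P + Q)"
    by (simp only: add.commute)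
  then have PQ: "ennreal (1 / 2) \<le> P + Q"
    unfolding ennreal_add_left_cancel_le by (simp only: infinity_ennreal_def ennreal_neq_top simp_thms)
  have "ennreal (\<eta>\<^sup>2 / 2) = ennreal (\<eta>\<^sup>2) * ennreal (1 / 2)"
    by (subst ennreal_mult[symmetric]) simp_all
  also have "\<dots> \<le> ennreal (\<eta>\<^sup>2) * P + ennreal (\<eta>\<^sup>2) * Q"
    using PQ by (simp add: mult_left_mono flip: distrib_left)
  also have "\<dots> \<le> risk k n \<A> (clique_graphon a) + risk k n \<A> (clique_graphon b)"
    unfolding P_def Q_def using ab \<open>0 \<le> \<eta>\<close> E F far far'
    by (intro add_mono risk_clique_graphon_ge sets; linarith?)
  finally show ?thesis
    by (simp add: \<eta>_def)
qed

section \<open>Choice of the two thresholds and of the constant\<close>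

theorem theorem3p3:
  shows "\<exists>c::real. c > 0 \<and>
    (\<forall>(k::nat) (n::nat) (\<epsilon>::real). 2 \<le> k \<longrightarrow> k \<le> n \<longrightarrow> 0 < \<epsilon> \<longrightarrow>
       minimax_rate k \<epsilon> n \<ge> ennreal (c * min 1 (1 / ((real n)\<^sup>2 * \<epsilon>\<^sup>2))))"
proof (intro exI[of _ "1 / 256"] conjI allI impI)
  fix k n :: nat and \<epsilon> :: real
  assume k: "2 \<le> k" "k \<le> n" and \<epsilon>: "0 < \<epsilon>"
  \<comment> \<open>Here 256 = 16 * 4 * 2 * 2: the square of the 4 in \<open>\<delta>\<close>, the
    square of the half in \<open>\<eta>\<close>, the total error 1/2, and the passage from the sum
    of two risks to their maximum.\<close>
  let ?r = "1 / 256 * min 1 (1 / ((real n)\<^sup>2 * \<epsilon>\<^sup>2))"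
  \<comment> \<open>The cap by 1 keeps \<open>b\<close> at most 3/4, as membership in
    \<open>step_graphons\<close> requires; the other term keeps the expected privacy loss below
    1/2.\<close>
  define \<delta> where "\<delta> = min 1 (1 / (real n * \<epsilon>)) / 4"
  define b where "b = 1 / 2 + \<delta>"
  have n: "0 < real n * \<epsilon>"
    using k \<epsilon> by simp
  then have \<delta>: "0 \<le> \<delta>" "\<delta> \<le> 1 / 4"
    by (auto simp: \<delta>_def)
  have "real n * \<epsilon> * \<delta> \<le> real n * \<epsilon> * (1 / (4 * (real n * \<epsilon>)))"
    using n by (intro mult_left_mono) (auto simp: \<delta>_def min_def)
  also have "\<dots> = 1 / 4"
    using k \<epsilon> by simp
  finally have gap: "\<epsilon> * (real n * (b - 1 / 2)) \<le> 1 / 2"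
    using n by (simp add: b_def mult_ac)
  have "(min 1 (1 / x))\<^sup>2 = min 1 (1 / x\<^sup>2)" if "0 < x" for x :: real
    using that one_le_power[of x 2] power_le_one[of x 2]
    by (cases "1 \<le> x") (simp_all add: min_absorb1 min_absorb2 power_divide)
  from this[OF n] have sq: "\<delta>\<^sup>2 = min 1 (1 / ((real n)\<^sup>2 * \<epsilon>\<^sup>2)) / 16"
    by (simp only: \<delta>_def power_divide power_mult_distrib) simp
  \<comment> \<open>The difference of squares equals \<open>\<delta>\<close> plus the square of
    \<open>\<delta>\<close>.\<close>
  have "\<delta> \<le> b\<^sup>2 - (1 / 2)\<^sup>2"
    using \<delta> by (simp add: b_def power2_eq_square algebra_simps)
  then have "(\<delta> / 2)\<^sup>2 \<le> ((b\<^sup>2 - (1 / 2)\<^sup>2) / 2)\<^sup>2"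
    using \<delta> by (intro power_mono) auto
  then have r: "2 * ?r \<le> ((b\<^sup>2 - (1 / 2)\<^sup>2) / 2)\<^sup>2 / 2"
    using sq by (simp add: power_divide)
  show "ennreal ?r \<le> minimax_rate k \<epsilon> n"
    unfolding minimax_rate_def
  proof (rule INF_greatest)
    fix \<A> assume \<A>: "\<A> \<in> node_dp_algorithms k \<epsilon> n"
    let ?M = "SUP W\<in>step_graphons k. risk k n \<A> W"
    have M: "risk k n \<A> (clique_graphon c) \<le> ?M" if "1 / 4 \<le> c" "c \<le> 3 / 4" for c
      using clique_graphon_in_step_graphons[OF k(1) that] by (rule SUP_upper)
    have "2 * ennreal ?r = ennreal (2 * ?r)"
      by (subst ennreal_mult) auto
    also have "\<dots> \<le> ennreal (((b\<^sup>2 - (1 / 2)\<^sup>2) / 2)\<^sup>2 / 2)"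
      using r by (rule ennreal_leI)
    also have "\<dots> \<le> risk k n \<A> (clique_graphon (1 / 2)) + risk k n \<A> (clique_graphon b)"
      using \<delta> gap by (intro two_point_bound[OF \<A> \<epsilon>]) (auto simp: b_def)
    also have "\<dots> \<le> 2 * ?M"
      \<comment> \<open>Each of the two risks is at most the supremum; the common factor 2 is then
        cancelled.\<close>
      unfolding mult_2 using \<delta> by (intro add_mono M) (auto simp: b_def)
    finally show "ennreal ?r \<le> ?M"
      by (simp add: ennreal_mult_le_mult_iff)
  qed
qed simp

end
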